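(* Let $\alpha=\dfrac{c_1c_2+\sqrt{c_1^2c_2^2-4c_1c_2}}{2c_2}$ and $\beta=\dfrac{c_1c_2-\sqrt{c_1^2c_2^2-4c_1c_2}}{2c_2}$. (i) If $\dfrac{\lambda_1}{-\lambda_2}>\alpha$, then $B_0(\lambda)$ has the highest weight vector. (ii) If $\beta>\dfrac{\lambda_1}{-\lambda_2}$, then $B_0(\lambda)$ has the lowest weight vector.
   Context: Setting. Let $c_1,c_2$ be positive integers with $c_1c_2\ge 4$, and let $\mathfrak g$ be the rank 2 Kac–Moody algebra (of affine or hyperbolic type), $I=\{1,2\}$, with simple roots $\alpha_i$, simple coroots $h_i$ and Cartan matrix $\langle h_1,\alpha_1\rangle=\langle h_2,\alpha_2\rangle=2$, $\langle h_1,\alpha_2\rangle=-c_1$, $\langle h_2,\alpha_1\rangle=-c_2$. Let $\lambda=\lambda_1\Lambda_1+\lambda_2\Lambda_2$ with $\Lambda_i$ the fundamental weights (so $\langle h_i,\lambda\rangle=\lambda_i$), $\lambda_1\in\mathbb Z_{>0}$, $\lambda_2\in\mathbb Z_{<0}$. The crystal $\mathbb Z^\infty_\iota[\lambda]$. Fix $\iota=(\dots,i_2,i_1,t_\lambda,i_{-1},i_{-2},\dots)=(\dots,1,2,1,t_\lambda,2,1,2,\dots)$, i.e. $i_k=1$ for $k>0$ odd, $i_k=2$ for $k>0$ even, $i_{-k}=2$ for $k>0$ odd, $i_{-k}=1$ for $k>0$ even. As a set, $\mathbb Z^\infty_\iota[\lambda]$ consists of the sequences $\vec x=(\dots,x_2,x_1,t_\lambda,x_{-1},x_{-2},\dots)$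 with $x_k\in\mathbb Z$ ($k\in\mathbb Z\setminus\{0\}$), all but finitely many zero ($t_\lambda$ is a formal symbol). There is no coordinate $x_0$; sums run over nonzero indices. Put $\sigma_k(\vec x)=x_k+\sum_{j>k}\langle h_{i_k},\alpha_{i_j}\rangle x_j$ for $k\ge1$ and $\sigma_k(\vec x)=-\langle h_{i_k},\lambda\rangle+x_k+\sum_{j>k}\langle h_{i_k},\alpha_{i_j}\rangle x_j$ for $k\le -1$. Let $\sigma^{(i)}(\vec x)=\max_{k:\,i_k=i}\sigma_k(\vec x)$ and $M^{(i)}=\{k: i_k=i,\ \sigma_k(\vec x)=\sigma^{(i)}(\vec x)\}$. The crystal operators are: $\tilde e_i\vec x$ is obtained from $\vec x$ by decreasing $x_{\max M^{(i)}}$ by 1 if $\max M^{(i)}$ exists, and $\tilde e_i\vec x=0$ otherwise; $\tilde f_i\vec x$ is obtained from $\vec x$ by increasing $x_{\min M^{(i)}}$ by 1 if $\min M^{(i)}$ exists, and $\tilde f_i\vec x=0$ otherwise. Also $wt(\vec x)=\lambda-\sum_j x_j\alpha_{i_j}$, $\varepsilon_i(\vec x)=\sigma^{(i)}(\vec x)$, $\varphi_i(\vec x)=\langle h_i,wt(\vec x)\rangle+\varepsilon_i(\vec x)$. $B_0(\lambda)$. The crystal $B(U_q(\mathfrak g)a_\lambda)\cong B(\infty)\otimes T_\lambda\otimes B(-\infty)$ of the modified quantum algebra is identified with its image under the unique strict embedding into $\mathbb Z^\infty_\iota[\lambda]$ sending $u_\infty\otimes t_\lambda\otimes u_{-\infty}$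 to $(\dots,0,0,t_\lambda,0,0,\dots)$. $B_0(\lambda)$ is its connected component containing $u_\infty\otimes t_\lambda\otimes u_{-\infty}$; equivalently, the connected component of $(\dots,0,0,t_\lambda,0,0,\dots)$ in $\mathbb Z^\infty_\iota[\lambda]$. A highest (resp. lowest) weight vector of a crystal is an element $b$ with $\tilde e_ib=0$ (resp. $\tilde f_ib=0$) for all $i\in I$. *)

theory Defs
  imports Complex_Main
begin

datatype idx = I1 | I2

text \<open>\<open>cartan c1 c2 i j\<close> is \<open>\<langle>h\<^sub>i, \<alpha>\<^sub>j\<rangle>\<close>.\<close>

fun cartan :: "int \<Rightarrow> int \<Rightarrow> idx \<Rightarrow> idx \<Rightarrow> int" where
  "cartan c1 c2 I1 I1 = 2"
| "cartan c1 c2 I1 I2 = - c1"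
| "cartan c1 c2 I2 I1 = - c2"
| "cartan c1 c2 I2 I2 = 2"

text \<open>
  A weight \<open>\<lambda>\<close> enters the crystal operators only through its pairings with the simple coroots, so
  it is represented by the function \<open>i \<mapsto> \<langle>h\<^sub>i, \<lambda>\<rangle>\<close>. The weight below is
  \<open>\<lambda>\<^sub>1 \<Lambda>\<^sub>1 + \<lambda>\<^sub>2 \<Lambda>\<^sub>2\<close>.
\<close>

fun fund_comb :: "int \<Rightarrow> int \<Rightarrow> idx \<Rightarrow> int" where
  "fund_comb l1 l2 I1 = l1"
| "fund_comb l1 l2 I2 = l2"

text \<open>
  The sequence \<open>\<iota> = (\<dots>,1,2,1,t\<^sub>\<lambda>,2,1,2,\<dots>)\<close>. Position \<open>0\<close> is
  occupied by the formal symbol \<open>t\<^sub>\<lambda>\<close>; the value \<open>iota 0\<close> is never used.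
\<close>

definition iota :: "int \<Rightarrow> idx" where
  "iota k = (if k > 0 then (if odd k then I1 else I2) else (if odd k then I2 else I1))"

text \<open>
  The underlying set of \<open>\<int>\<^sup>\<infinity>\<^sub>\<iota>[\<lambda>]\<close>. There is no coordinate at
  \<open>0\<close>, which is encoded by fixing the value \<open>0\<close> there.
\<close>

definition Zinf :: "(int \<Rightarrow> int) set" where
  "Zinf = {x. x 0 = 0 \<and> finite {k. x k \<noteq> 0}}"

text \<open>
  The summation over \<open>j > k\<close> is restricted to the support of \<open>x\<close>, which is finite for
  \<open>x \<in> Zinf\<close> (\<open>sum\<close> over an infinite set would be \<open>0\<close>).
\<close>

definition sigma :: "(idx \<Rightarrow> idx \<Rightarrow> int) \<Rightarrow> (idx \<Rightarrow> int) \<Rightarrow> int \<Rightarrow> (int \<Rightarrow> int) \<Rightarrow> int" where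
  "sigma A lam k x =
     (if k < 0 then - lam (iota k) else 0) + x k
       + (\<Sum>j | j > k \<and> x j \<noteq> 0. A (iota k) (iota j) * x j)"

definition sigma_max :: "(idx \<Rightarrow> idx \<Rightarrow> int) \<Rightarrow> (idx \<Rightarrow> int) \<Rightarrow> idx \<Rightarrow> (int \<Rightarrow> int) \<Rightarrow> int" where
  "sigma_max A lam i x = Max {sigma A lam k x | k. k \<noteq> 0 \<and> iota k = i}"

definition M_set :: "(idx \<Rightarrow> idx \<Rightarrow> int) \<Rightarrow> (idx \<Rightarrow> int) \<Rightarrow> idx \<Rightarrow> (int \<Rightarrow> int) \<Rightarrow> int set" where
  "M_set A lam i x = {k. k \<noteq> 0 \<and> iota k = i \<and> sigma A lam k x = sigma_max A lam i x}"

text \<open>The maximum defining \<open>sigma_max\<close> is taken over a finite nonempty set.\<close>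

lemma finite_sigma_values:
  assumes "x \<in> Zinf"
  shows "finite {sigma A lam k x | k. k \<noteq> 0 \<and> iota k = i}"
proof -
  let ?S = "{k. x k \<noteq> 0}"
  have S: "finite ?S" using assms by (simp add: Zinf_def)
  let ?g = "\<lambda>(u, v, T). u + v + (\<Sum>j\<in>T. A i (iota j) * x j)"
  have "range x \<subseteq> insert 0 (x ` ?S)" by auto
  then have "finite (range x)" using S finite_subset by blast
  then have "finite (?g ` ({- lam i, 0} \<times> range x \<times> Pow ?S))" using S by auto
  moreover have "{sigma A lam k x | k. k \<noteq> 0 \<and> iota k = i}
      \<subseteq> ?g ` ({- lam i, 0} \<times> range x \<times> Pow ?S)"
  proof
    fix s assume "s \<in> {sigma A lam k x | k. k \<noteq> 0 \<and> iota k = i}"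
    then obtain k where "iota k = i" "s = sigma A lam k x" by auto
    then have "s = ?g (if k < 0 then - lam i else 0, x k, {j. j > k \<and> x j \<noteq> 0})"
      by (simp add: sigma_def)
    then show "s \<in> ?g ` ({- lam i, 0} \<times> range x \<times> Pow ?S)"
      by (rule image_eqI) auto
  qed
  ultimately show ?thesis using finite_subset by blast
qed

lemma sigma_values_nonempty: "{sigma A lam k x | k. k \<noteq> 0 \<and> iota k = i} \<noteq> {}"
proof (cases i)
  case I1
  then have "(1::int) \<noteq> 0 \<and> iota 1 = i" by (simp add: iota_def)
  then show ?thesis by blast
next
  case I2
  then have "(2::int) \<noteq> 0 \<and> iota 2 = i" by (simp add: iota_def)
  then show ?thesis by blast
qed

text \<open>
  The set \<open>M_set\<close> may be unbounded above or below, so its maximum or minimum need not exist.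
  \<open>None\<close> plays the role of the crystal element \<open>0\<close>.
\<close>

definition e_op :: "(idx \<Rightarrow> idx \<Rightarrow> int) \<Rightarrow> (idx \<Rightarrow> int) \<Rightarrow> idx \<Rightarrow> (int \<Rightarrow> int) \<Rightarrow> (int \<Rightarrow> int) option" where
  "e_op A lam i x =
     (if \<exists>m\<in>M_set A lam i x. \<forall>k\<in>M_set A lam i x. k \<le> m
      then let m = (THE m. m \<in> M_set A lam i x \<and> (\<forall>k\<in>M_set A lam i x. k \<le> m))
           in Some (x(m := x m - 1))
      else None)"

definition f_op :: "(idx \<Rightarrow> idx \<Rightarrow> int) \<Rightarrow> (idx \<Rightarrow> int) \<Rightarrow> idx \<Rightarrow> (int \<Rightarrow> int) \<Rightarrow> (int \<Rightarrow> int) option" where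
  "f_op A lam i x =
     (if \<exists>m\<in>M_set A lam i x. \<forall>k\<in>M_set A lam i x. m \<le> k
      then let m = (THE m. m \<in> M_set A lam i x \<and> (\<forall>k\<in>M_set A lam i x. m \<le> k))
           in Some (x(m := x m + 1))
      else None)"

definition crystal_edge :: "(idx \<Rightarrow> idx \<Rightarrow> int) \<Rightarrow> (idx \<Rightarrow> int) \<Rightarrow> (int \<Rightarrow> int) \<Rightarrow> (int \<Rightarrow> int) \<Rightarrow> bool" where
  "crystal_edge A lam x y \<longleftrightarrow>
     x \<in> Zinf \<and> y \<in> Zinf \<and> (\<exists>i. e_op A lam i x = Some y \<or> f_op A lam i x = Some y)"

text \<open>
  \<open>B\<^sub>0(\<lambda>)\<close>, realized as the connected component of
  \<open>(\<dots>,0,0,t\<^sub>\<lambda>,0,0,\<dots>)\<close> in \<open>\<int>\<^sup>\<infinity>\<^sub>\<iota>[\<lambda>]\<close>. By the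
  strict embedding of \<open>B(\<infinity>) \<otimes> T\<^sub>\<lambda> \<otimes> B(-\<infinity>)\<close> this is the component of
  \<open>u\<^sub>\<infinity> \<otimes> t\<^sub>\<lambda> \<otimes> u\<^sub>-\<^sub>\<infinity>\<close>.
\<close>

definition B0 :: "(idx \<Rightarrow> idx \<Rightarrow> int) \<Rightarrow> (idx \<Rightarrow> int) \<Rightarrow> (int \<Rightarrow> int) set" where
  "B0 A lam = {x. equivclp (crystal_edge A lam) (\<lambda>_. 0) x}"

definition highest_weight_vector :: "(idx \<Rightarrow> idx \<Rightarrow> int) \<Rightarrow> (idx \<Rightarrow> int) \<Rightarrow> (int \<Rightarrow> int) \<Rightarrow> bool" where
  "highest_weight_vector A lam b \<longleftrightarrow> (\<forall>i. e_op A lam i b = None)"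

definition lowest_weight_vector :: "(idx \<Rightarrow> idx \<Rightarrow> int) \<Rightarrow> (idx \<Rightarrow> int) \<Rightarrow> (int \<Rightarrow> int) \<Rightarrow> bool" where
  "lowest_weight_vector A lam b \<longleftrightarrow> (\<forall>i. f_op A lam i b = None)"

end

theory Submission
  imports Defs
begin

text \<open>
  The element of \<open>B0\<close> at the origin has weight \<open>\<lambda>\<close>. Raising it as far as possible in the
  direction \<open>I2\<close>, then \<open>I1\<close>, then \<open>I2\<close>, and so on, applies the simple reflections \<open>s\<^sub>2\<close>, \<open>s\<^sub>1\<close>,
  \<open>s\<^sub>2\<close>, \<open>\<dots>\<close> to the weight, and the condition \<open>\<lambda>\<^sub>1 / (- \<lambda>\<^sub>2) > \<alpha>\<close> guarantees that this brings
  \<open>\<lambda>\<close> into the dominant chamber. In coordinates, the \<open>n\<close>-th round changes only \<open>x\<^sub>-\<^sub>n\<close>, which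
  descends from \<open>0\<close> to \<open>- a\<^sub>n\<close>, where \<open>a\<^sub>0 = \<lambda>\<^sub>1\<close>, \<open>a\<^sub>1 = - \<lambda>\<^sub>2\<close> and
  \<open>a\<^sub>n\<^sub>+\<^sub>2 = c a\<^sub>n\<^sub>+\<^sub>1 - a\<^sub>n\<close> with \<open>c\<close> alternating between \<open>c\<^sub>1\<close> and \<open>c\<^sub>2\<close> (\<open>refl_seq\<close>). These
  points are called stages, and their values \<open>\<sigma>\<^sub>k\<close> are explicit (\<open>sigma_stage_neg\<close>): at a completed
  stage \<open>n\<close> the only possibly positive one among those relevant for the next colour is \<open>a\<^sub>n\<^sub>+\<^sub>1\<close>. If
  it is positive, the next round can be carried out (\<open>e_op_stage\<close>). If it is not, then both maxima
  are \<open>0\<close> and are attained at arbitrarily large positive positions, so both raising operators vanish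
  (\<open>stage_highest\<close>).

  The numbers \<open>\<alpha>\<close> and \<open>\<beta>\<close> are the roots of \<open>c\<^sub>2 t\<^sup>2 - c\<^sub>1 c\<^sub>2 t + c\<^sub>1\<close>, the fixed point equation of
  the map taking the ratio \<open>a\<^sub>2\<^sub>n / a\<^sub>2\<^sub>n\<^sub>+\<^sub>1\<close> to the next one. A ratio above \<open>\<alpha>\<close> stays above
  \<open>\<alpha>\<close> as long as all terms are positive, and this forces the integers \<open>a\<^sub>2\<^sub>n\<close> to decrease strictly;
  hence some \<open>a\<^sub>n\<close> is not positive (\<open>refl_seq_eventually_nonpos\<close>).

  The second half follows from the first by symmetry. Replacing \<open>x\<^sub>k\<close> by \<open>- x\<^sub>-\<^sub>k\<close> exchanges the two
  colours, the two Cartan entries, raising and lowering operators, and \<open>\<lambda>\<close> and \<open>- \<lambda>\<close>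
  (\<open>f_op_dual\<close>, \<open>highest_dual\<close>). The ratio \<open>\<lambda>\<^sub>1 / (- \<lambda>\<^sub>2)\<close> becomes its inverse, and the
  larger root for the exchanged Cartan matrix is \<open>1 / \<beta>\<close>.
\<close>

section \<open>Characterising the signature maxima\<close>

lemma M_set_iff_argmax:
  assumes "x \<in> Zinf"
  shows "k \<in> M_set A lam i x \<longleftrightarrow> k \<noteq> 0 \<and> iota k = i \<and>
           (\<forall>k'. k' \<noteq> 0 \<longrightarrow> iota k' = i \<longrightarrow> sigma A lam k' x \<le> sigma A lam k x)"
proof -
  let ?V = "{sigma A lam k x | k. k \<noteq> 0 \<and> iota k = i}"
  have fin: "finite ?V" and ne: "?V \<noteq> {}"
    by (rule finite_sigma_values[OF assms], rule sigma_values_nonempty)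
  have max: "sigma A lam k x = Max ?V \<longleftrightarrow> (\<forall>v\<in>?V. v \<le> sigma A lam k x)"
    if k: "k \<noteq> 0" "iota k = i"
  proof -
    have "sigma A lam k x \<in> ?V" by (intro CollectI exI[of _ k]) (simp add: k)
    then show ?thesis using Max_eq_iff[OF fin ne, of "sigma A lam k x"] by (simp only: eq_commute) blast
  qed
  have "(\<forall>v\<in>?V. v \<le> sigma A lam k x)
      \<longleftrightarrow> (\<forall>k'. k' \<noteq> 0 \<longrightarrow> iota k' = i \<longrightarrow> sigma A lam k' x \<le> sigma A lam k x)" by blast
  with max show ?thesis unfolding M_set_def sigma_max_def mem_Collect_eq by argo
qed

lemma e_op_SomeI:
  assumes "m \<in> M_set A lam i x" and "\<And>k. k \<in> M_set A lam i x \<Longrightarrow> k \<le> m"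
  shows "e_op A lam i x = Some (x(m := x m - 1))"
proof -
  have "(THE m. m \<in> M_set A lam i x \<and> (\<forall>k\<in>M_set A lam i x. k \<le> m)) = m"
    using assms by (intro the_equality) (auto intro: antisym)
  then show ?thesis using assms unfolding e_op_def by auto
qed

lemma f_op_SomeI:
  assumes "m \<in> M_set A lam i x" and "\<And>k. k \<in> M_set A lam i x \<Longrightarrow> m \<le> k"
  shows "f_op A lam i x = Some (x(m := x m + 1))"
proof -
  have "(THE m. m \<in> M_set A lam i x \<and> (\<forall>k\<in>M_set A lam i x. m \<le> k)) = m"
    using assms by (intro the_equality) (auto intro: antisym)
  then show ?thesis using assms unfolding f_op_def by auto
qed

lemma e_op_NoneI:
  assumes "\<And>m. m \<in> M_set A lam i x \<Longrightarrow> \<exists>k\<in>M_set A lam i x. m < k"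
  shows "e_op A lam i x = None"
  using assms unfolding e_op_def by (meson not_le)

text \<open>
  Peeling one term off the tail sum, whether or not it lies in the support, avoids case
  distinctions on vanishing coordinates.
\<close>

lemma sum_tail_split:
  assumes "x \<in> Zinf"
  shows "(\<Sum>j | j > k \<and> x j \<noteq> 0. F j * x j) =
         F (k + 1) * x (k + 1) + (\<Sum>j | j > k + 1 \<and> x j \<noteq> 0. F j * x j)" (is "?L = _ + ?R")
proof -
  have fin: "finite {j. P j \<and> x j \<noteq> 0}" for P
    using assms by (auto simp: Zinf_def intro: rev_finite_subset)
  have eq: "{j. j > k \<and> x j \<noteq> 0} =
      (if x (k + 1) = 0 then {j. j > k + 1 \<and> x j \<noteq> 0}
       else insert (k + 1) {j. j > k + 1 \<and> x j \<noteq> 0})"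
  proof -
    have "j > k \<longleftrightarrow> j = k + 1 \<or> j > k + 1" for j by linarith
    then show ?thesis by auto
  qed
  show ?thesis unfolding eq using fin by auto
qed

lemma iota_add2: "k < - 2 \<Longrightarrow> iota (k + 2) = iota k"
  by (auto simp: iota_def)

text \<open>
  Two consecutive positions of the same colour see the same coroot, so their values differ only by
  the three coordinates from one to the other. The bound on \<open>k\<close> keeps both positions to the left of
  the symbol at \<open>0\<close>, where the term \<open>- \<langle>h\<^sub>i, \<lambda>\<rangle>\<close> is the same.
\<close>

lemma sigma_step:
  assumes "x \<in> Zinf" and "k < - 2" and "\<And>i. A i i = 2"
  shows "sigma A lam k x = sigma A lam (k + 2) x + x k + x (k + 2)
           + A (iota k) (iota (k + 1)) * x (k + 1)"
  using assms(2,3) iota_add2[of k]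
    sum_tail_split[OF assms(1), where k = k and F = "\<lambda>j. A (iota k) (iota j)"]
    sum_tail_split[OF assms(1), where k = "k + 1" and F = "\<lambda>j. A (iota k) (iota j)"]
  by (simp add: sigma_def add.commute[of k 2])

section \<open>Duality between raising and lowering operators\<close>

fun swap :: "idx \<Rightarrow> idx" where
  "swap I1 = I2"
| "swap I2 = I1"

lemma swap_swap [simp]: "swap (swap i) = i"
  by (cases i) auto

text \<open>
  The sign makes lowering a coordinate correspond to raising its mirror image.
\<close>

definition dual :: "(int \<Rightarrow> int) \<Rightarrow> (int \<Rightarrow> int)" where
  "dual x = (\<lambda>k. - x (- k))"

lemma dual_dual [simp]: "dual (dual x) = x"
  by (simp add: dual_def)

lemma dual_in_Zinf:
  assumes "x \<in> Zinf" shows "dual x \<in> Zinf"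
proof -
  have "{k. dual x k \<noteq> 0} = uminus ` {k. x k \<noteq> 0}"
    by (force simp: dual_def image_iff)
  then show ?thesis using assms by (simp add: Zinf_def dual_def)
qed

lemma iota_uminus: "k \<noteq> 0 \<Longrightarrow> iota (- k) = swap (iota k)"
  by (auto simp: iota_def)

lemma cartan_swap: "cartan c2 c1 (swap i) (swap j) = cartan c1 c2 i j"
  by (cases i; cases j) auto

text \<open>
  Reflection turns the sum over \<open>j > k\<close> into minus the sum over \<open>j < k\<close>, which is the former sum
  minus the sum over all positions; the diagonal entry \<open>2\<close> gives \<open>x\<^sub>k\<close> the right sign. What is left
  over is \<open>- \<langle>h\<^sub>i, wt(x)\<rangle>\<close>. It depends on \<open>k\<close> only through the colour, so it does not affect where
  the maximum is attained.
\<close>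

lemma sigma_dual:
  assumes x: "x \<in> Zinf" and k: "k \<noteq> 0" and diag: "\<And>i. A i i = 2"
    and A': "\<And>i j. A' (swap i) (swap j) = A i j" and lam': "\<And>i. lam' (swap i) = - lam i"
  shows "sigma A lam k x = sigma A' lam' (- k) (dual x)
           + ((\<Sum>j | x j \<noteq> 0. A (iota k) (iota j) * x j) - lam (iota k))"
proof -
  let ?F = "\<lambda>j. A (iota k) (iota j) * x j"
  have fin: "finite {j. P j \<and> x j \<noteq> 0}" for P
    using x by (auto simp: Zinf_def intro: rev_finite_subset)
  have x0: "x 0 = 0" using x by (simp add: Zinf_def)
  have "(\<Sum>j | j > - k \<and> dual x j \<noteq> 0. A' (iota (- k)) (iota j) * dual x j)
      = (\<Sum>j | j < k \<and> x j \<noteq> 0. A' (iota (- k)) (iota (- j)) * dual x (- j))"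
    by (rule sum.reindex_bij_witness[of _ uminus uminus]) (auto simp: dual_def)
  also have "\<dots> = (\<Sum>j | j < k \<and> x j \<noteq> 0. - ?F j)"
  proof (rule sum.cong[OF refl])
    fix j assume "j \<in> {j. j < k \<and> x j \<noteq> 0}"
    then have "j \<noteq> 0" using x0 by auto
    then show "A' (iota (- k)) (iota (- j)) * dual x (- j) = - ?F j"
      using k by (simp add: iota_uminus A' dual_def)
  qed
  finally have below: "(\<Sum>j | j > - k \<and> dual x j \<noteq> 0. A' (iota (- k)) (iota j) * dual x j)
      = - (\<Sum>j | j < k \<and> x j \<noteq> 0. ?F j)" by (simp add: sum_negf)
  have split: "{j. x j \<noteq> 0} = {j. j < k \<and> x j \<noteq> 0} \<union> {j. j \<ge> k \<and> x j \<noteq> 0}" by auto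
  have "(\<Sum>j | x j \<noteq> 0. ?F j)
      = (\<Sum>j | j < k \<and> x j \<noteq> 0. ?F j) + (\<Sum>j | j \<ge> k \<and> x j \<noteq> 0. ?F j)"
    by (subst split, rule sum.union_disjoint[OF fin fin], auto)
  also have "(\<Sum>j | j \<ge> k \<and> x j \<noteq> 0. ?F j) = 2 * x k + (\<Sum>j | j > k \<and> x j \<noteq> 0. ?F j)"
  proof -
    have "k - 1 < j \<longleftrightarrow> k \<le> j" for j by linarith
    then show ?thesis
      using sum_tail_split[OF x, where k = "k - 1" and F = "\<lambda>j. A (iota k) (iota j)"] diag by simp
  qed
  finally show ?thesis
    using below k by (auto simp: sigma_def iota_uminus lam' dual_def)
qed

lemma M_set_dual:
  assumes x: "x \<in> Zinf" and diag: "\<And>i. A i i = 2"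
    and A': "\<And>i j. A' (swap i) (swap j) = A i j" and lam': "\<And>i. lam' (swap i) = - lam i"
  shows "k \<in> M_set A' lam' (swap i) (dual x) \<longleftrightarrow> - k \<in> M_set A lam i x"
proof -
  note sd = sigma_dual[where A = A and A' = A' and lam = lam and lam' = lam', OF x _ diag A' lam']
  have swap_eq: "iota k = swap i \<longleftrightarrow> iota (- k) = i" if "k \<noteq> 0" for k
    using that by (metis iota_uminus swap_swap)
  have cmp: "sigma A' lam' k' (dual x) \<le> sigma A' lam' k (dual x)
      \<longleftrightarrow> sigma A lam (- k') x \<le> sigma A lam (- k) x"
    if "k \<noteq> 0" "k' \<noteq> 0" "iota k = swap i" "iota k' = swap i" for k k'
    using that sd[of "- k"] sd[of "- k'"] swap_eq by auto
  show ?thesis (is "?L \<longleftrightarrow> ?R")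
  proof
    assume ?L
    then have k: "k \<noteq> 0" "iota k = swap i" and
      mx: "\<And>k'. k' \<noteq> 0 \<Longrightarrow> iota k' = swap i \<Longrightarrow> sigma A' lam' k' (dual x) \<le> sigma A' lam' k (dual x)"
      by (auto simp: M_set_iff_argmax[OF dual_in_Zinf[OF x]])
    have "sigma A lam k' x \<le> sigma A lam (- k) x" if "k' \<noteq> 0" "iota k' = i" for k'
      using mx[of "- k'"] cmp[of k "- k'"] that k swap_eq[of "- k'"] by auto
    then show ?R using k swap_eq by (auto simp: M_set_iff_argmax[OF x])
  next
    assume ?R
    then have k: "k \<noteq> 0" "iota k = swap i" and
      mx: "\<And>k'. k' \<noteq> 0 \<Longrightarrow> iota k' = i \<Longrightarrow> sigma A lam k' x \<le> sigma A lam (- k) x"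
      using swap_eq by (auto simp: M_set_iff_argmax[OF x])
    have "sigma A' lam' k' (dual x) \<le> sigma A' lam' k (dual x)" if "k' \<noteq> 0" "iota k' = swap i" for k'
      using mx[of "- k'"] cmp[of k k'] that k swap_eq[of k'] by auto
    then show ?L using k by (auto simp: M_set_iff_argmax[OF dual_in_Zinf[OF x]])
  qed
qed

text \<open>
  Reflection reverses the order of positions, so the largest maximiser goes to the smallest one, and
  one exists exactly if the other does.
\<close>

lemma f_op_dual:
  assumes x: "x \<in> Zinf" and diag: "\<And>i. A i i = 2"
    and A': "\<And>i j. A' (swap i) (swap j) = A i j" and lam': "\<And>i. lam' (swap i) = - lam i"
  shows "f_op A' lam' (swap i) (dual x) = map_option dual (e_op A lam i x)"
proof -
  note M = M_set_dual[where A = A and A' = A' and lam = lam and lam' = lam', OF x diag A' lam']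
  show ?thesis
  proof (cases "\<exists>m\<in>M_set A lam i x. \<forall>k\<in>M_set A lam i x. k \<le> m")
    case True
    then obtain m where m: "m \<in> M_set A lam i x" "\<And>k. k \<in> M_set A lam i x \<Longrightarrow> k \<le> m" by blast
    have "f_op A' lam' (swap i) (dual x) = Some ((dual x)(- m := dual x (- m) + 1))"
    proof (rule f_op_SomeI)
      show "- m \<in> M_set A' lam' (swap i) (dual x)" using m(1) by (simp add: M)
      show "- m \<le> k" if "k \<in> M_set A' lam' (swap i) (dual x)" for k
        using m(2)[of "- k"] that by (simp add: M)
    qed
    moreover have "(dual x)(- m := dual x (- m) + 1) = dual (x(m := x m - 1))"
      by (auto simp: dual_def)
    ultimately show ?thesis using e_op_SomeI[OF m] by simp
  next
    case False
    have "\<not> (\<exists>m\<in>M_set A' lam' (swap i) (dual x). \<forall>k\<in>M_set A' lam' (swap i) (dual x). m \<le> k)"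
    proof
      assume "\<exists>m\<in>M_set A' lam' (swap i) (dual x). \<forall>k\<in>M_set A' lam' (swap i) (dual x). m \<le> k"
      then obtain m where m: "m \<in> M_set A' lam' (swap i) (dual x)"
        "\<And>k. k \<in> M_set A' lam' (swap i) (dual x) \<Longrightarrow> m \<le> k" by blast
      have "- m \<in> M_set A lam i x" using m(1) by (simp add: M)
      moreover have "k \<le> - m" if "k \<in> M_set A lam i x" for k
        using m(2)[of "- k"] that by (simp add: M)
      ultimately show False using False by blast
    qed
    then have "f_op A' lam' (swap i) (dual x) = None" unfolding f_op_def by (rule if_not_P)
    moreover have "e_op A lam i x = None" unfolding e_op_def by (rule if_not_P[OF False])
    ultimately show ?thesis by simp
  qed
qed

text \<open>
  The origin is its own mirror image, so reflection maps the component of the origin into the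
  corresponding component of the dual crystal.
\<close>

lemma highest_dual:
  assumes b: "b \<in> B0 A lam" "b \<in> Zinf" "highest_weight_vector A lam b" and diag: "\<And>i. A i i = 2"
    and A': "\<And>i j. A' (swap i) (swap j) = A i j" and lam': "\<And>i. lam' (swap i) = - lam i"
  shows "dual b \<in> B0 A' lam' \<and> lowest_weight_vector A' lam' (dual b)"
proof -
  have A: "A (swap i) (swap j) = A' i j" for i j using A'[of "swap i" "swap j"] by simp
  have lam: "lam (swap i) = - lam' i" for i using lam'[of "swap i"] by simp
  have diag': "A' i i = 2" for i using A'[of "swap i" "swap i"] diag by simp
  have f: "f_op A' lam' (swap i) (dual x) = map_option dual (e_op A lam i x)" if "x \<in> Zinf" for i x
    using that diag A' lam' by (rule f_op_dual)
  have e: "e_op A' lam' (swap i) (dual x) = map_option dual (f_op A lam i x)" if "x \<in> Zinf" for i x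
  proof -
    have "f_op A lam (swap (swap i)) (dual (dual x)) = map_option dual (e_op A' lam' (swap i) (dual x))"
      using dual_in_Zinf[OF that] diag' A lam by (rule f_op_dual)
    then show ?thesis by (simp add: option.map_comp comp_def option.map_ident)
  qed
  have edge: "crystal_edge A' lam' (dual x) (dual y)" if "crystal_edge A lam x y" for x y
    using that f[of x] e[of x] unfolding crystal_edge_def
    by (metis dual_in_Zinf option.simps(9))
  have "equivclp (crystal_edge A lam) (\<lambda>_. 0) b" using b(1) by (simp add: B0_def)
  then have "equivclp (crystal_edge A' lam') (dual (\<lambda>_. 0)) (dual b)"
  proof (induction rule: equivclp_induct)
    case base
    then show ?case by simp
  next
    case (step y z)
    then show ?case by (meson edge equivclp_into_equivclp)
  qed
  moreover have "dual (\<lambda>_. 0) = (\<lambda>_. 0)" by (simp add: dual_def)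
  ultimately have "dual b \<in> B0 A' lam'" by (simp add: B0_def)
  moreover have "f_op A' lam' i (dual b) = None" for i
    using f[OF b(2), of "swap i"] b(3) by (simp add: highest_weight_vector_def)
  ultimately show ?thesis by (simp add: lowest_weight_vector_def)
qed

section \<open>The sequence of simple reflections\<close>

text \<open>
  Let \<open>\<mu>\<^sub>n\<close> be the weight obtained from \<open>\<lambda>\<close> by \<open>n\<close> alternating reflections beginning with
  \<open>s\<^sub>2\<close>. Its pairings with the coroots of the last and of the next reflection are the \<open>n\<close>-th term and
  minus the \<open>Suc n\<close>-th term (for \<open>n = 0\<close>, the former coroot is \<open>h\<^sub>1\<close>).
\<close>

fun refl_seq :: "int \<Rightarrow> int \<Rightarrow> int \<Rightarrow> int \<Rightarrow> nat \<Rightarrow> int" where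
  "refl_seq c1 c2 l1 l2 0 = l1"
| "refl_seq c1 c2 l1 l2 (Suc 0) = - l2"
| "refl_seq c1 c2 l1 l2 (Suc (Suc n)) =
     (if even n then c1 else c2) * refl_seq c1 c2 l1 l2 (Suc n) - refl_seq c1 c2 l1 l2 n"

text \<open>
  If all terms were positive, the inequality \<open>a\<^sub>2\<^sub>n > \<alpha> a\<^sub>2\<^sub>n\<^sub>+\<^sub>1\<close> would propagate: it gives
  \<open>a\<^sub>2\<^sub>n\<^sub>+\<^sub>2 < \<beta> a\<^sub>2\<^sub>n\<^sub>+\<^sub>1\<close>, and the relations between roots and coefficients turn this into the
  same inequality for \<open>n + 1\<close>. As \<open>\<beta> \<le> \<alpha>\<close>, it also gives \<open>a\<^sub>2\<^sub>n\<^sub>+\<^sub>2 < a\<^sub>2\<^sub>n\<close>, an infinite descent in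
  the positive integers.
\<close>

lemma refl_seq_eventually_nonpos:
  fixes c1 c2 l1 l2 :: int and \<alpha> \<beta> :: real
  assumes sum: "\<alpha> + \<beta> = c1" and prod: "c2 * (\<alpha> * \<beta>) = c1"
    and \<beta>: "0 < \<beta>" "\<beta> \<le> \<alpha>" and start: "\<alpha> * (- l2) < l1"
  shows "\<exists>n. refl_seq c1 c2 l1 l2 n \<le> 0"
proof (rule ccontr)
  assume "\<nexists>n. refl_seq c1 c2 l1 l2 n \<le> 0"
  then have pos: "refl_seq c1 c2 l1 l2 n > 0" for n by (simp add: not_le)
  define a where "a n = real_of_int (refl_seq c1 c2 l1 l2 n)" for n
  have apos: "a n > 0" for n using pos by (simp add: a_def)
  have rec_even: "a (2 * n + 2) = (\<alpha> + \<beta>) * a (2 * n + 1) - a (2 * n)" for n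
    by (simp add: a_def sum)
  have rec_odd: "a (2 * n + 3) = c2 * a (2 * n + 2) - a (2 * n + 1)" for n
    by (simp add: a_def numeral_3_eq_3)
  have ratio: "\<alpha> * a (2 * n + 1) < a (2 * n)" for n
  proof (induction n)
    case 0
    then show ?case using start by (simp add: a_def)
  next
    case (Suc n)
    have "a (2 * n + 2) < \<beta> * a (2 * n + 1)"
      using Suc unfolding rec_even by (simp add: algebra_simps)
    then have "\<alpha> * a (2 * n + 2) < \<alpha> * (\<beta> * a (2 * n + 1))" using \<beta> by simp
    moreover have "\<beta> * (\<alpha> * a (2 * n + 3))
        = (\<alpha> + \<beta>) * a (2 * n + 2) - \<alpha> * (\<beta> * a (2 * n + 1))"
      unfolding rec_odd sum prod[symmetric] by (simp add: algebra_simps)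
    ultimately have "\<beta> * (\<alpha> * a (2 * n + 3)) < \<beta> * a (2 * n + 2)" by (simp add: algebra_simps)
    then show ?case using \<beta> by (simp add: numeral_3_eq_3)
  qed
  have desc: "a (2 * n + 2) < a (2 * n)" for n
  proof -
    have "a (2 * n + 2) < \<beta> * a (2 * n + 1)"
      using ratio[of n] unfolding rec_even by (simp add: algebra_simps)
    also have "\<dots> \<le> \<alpha> * a (2 * n + 1)" using \<beta> apos[of "2 * n + 1"] by (simp add: mult_right_mono)
    also have "\<dots> < a (2 * n)" by (rule ratio)
    finally show ?thesis .
  qed
  have "refl_seq c1 c2 l1 l2 (2 * n) \<le> l1 - int n" for n
  proof (induction n)
    case (Suc n)
    have "refl_seq c1 c2 l1 l2 (2 * Suc n) < refl_seq c1 c2 l1 l2 (2 * n)"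
      using desc[of n] unfolding a_def of_int_less_iff by simp
    then show ?case using Suc by linarith
  qed simp
  from this[of "nat l1"] show False using pos[of "2 * nat l1"] pos[of 0] by simp
qed

section \<open>Climbing to the highest weight vector\<close>

text \<open>
  \<open>stage a n j\<close> is reached after \<open>n\<close> completed rounds and \<open>j\<close> steps of the following round.
\<close>

definition stage :: "(nat \<Rightarrow> int) \<Rightarrow> nat \<Rightarrow> int \<Rightarrow> (int \<Rightarrow> int)" where
  "stage a n j = (\<lambda>k. if - int n \<le> k \<and> k < 0 then - a (nat (- k))
                      else if k = - int n - 1 then - j else 0)"

lemma stage_in_Zinf: "stage a n j \<in> Zinf"
proof -
  have "{k. stage a n j k \<noteq> 0} \<subseteq> {- int n - 1..0}" by (auto simp: stage_def split: if_splits)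
  from finite_subset[OF this] have "finite {k. stage a n j k \<noteq> 0}" by simp
  then show ?thesis unfolding Zinf_def mem_Collect_eq by (simp add: stage_def)
qed

lemma stage_Suc: "stage a (Suc n) 0 = stage a n (a (Suc n))"
proof
  fix k
  have "nat (- k) = Suc n" if "k = - int n - 1" using that by simp
  then show "stage a (Suc n) 0 k = stage a n (a (Suc n)) k" by (auto simp: stage_def)
qed

lemma stage_neg: "stage a n j (- int (Suc l)) = (if l < n then - a (Suc l) else if l = n then - j else 0)"
  by (auto simp: stage_def nat_add_distrib)

lemma sigma_stage_pos: "k > 0 \<Longrightarrow> sigma A lam k (stage a n j) = 0"
proof -
  assume "k > 0"
  then have "{i. i > k \<and> stage a n j i \<noteq> 0} = {}" by (auto simp: stage_def)
  then show ?thesis using \<open>k > 0\<close> unfolding sigma_def by (auto simp: stage_def)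
qed

lemma iota_neg: "iota (- int (Suc l)) = (if even l then I2 else I1)"
  by (auto simp: iota_def)

text \<open>
  The recursion of \<open>refl_seq\<close> is exactly what makes the values at completed positions vanish. To the
  left of the active position \<open>- (n + 1)\<close> the coordinates are zero, so the values there repeat with
  period two.
\<close>

lemma sigma_stage_neg:
  fixes c1 c2 l1 l2 :: int
  defines "a \<equiv> refl_seq c1 c2 l1 l2"
  shows "sigma (cartan c1 c2) (fund_comb l1 l2) (- int (Suc l)) (stage a n j) =
    (if l < n then 0 else if l = n then a (Suc n) - j
     else if even (l - n) then a (Suc n) - 2 * j
     else (if even n then c1 else c2) * j - a n)"
proof (induction l rule: less_induct)
  case (less l)
  let ?x = "stage a n j"
  have empty: "{i. i > - 1 \<and> ?x i \<noteq> 0} = {}" by (auto simp: stage_def)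
  have m1: "?x (- 1) = (if 0 < n then - a 1 else - j)"
    and m2: "?x (- 2) = (if 1 < n then - a 2 else if n = 1 then - j else 0)"
    using stage_neg[of a n j 0] stage_neg[of a n j 1] by (auto simp: numeral_2_eq_2)
  have a1: "a 1 = - l2" and a2: "a 2 = c1 * a 1 - l1" by (simp_all add: a_def numeral_2_eq_2)
  consider "l = 0" | "l = 1" | p where "l = Suc (Suc p)" by (metis One_nat_def not0_implies_Suc)
  then show ?case
  proof cases
    case 1
    have "sigma (cartan c1 c2) (fund_comb l1 l2) (- 1) ?x = - l2 + ?x (- 1)"
      using empty by (simp add: sigma_def iota_def)
    then show ?thesis using 1 m1 a1 by (simp)
  next
    case 2
    have "sigma (cartan c1 c2) (fund_comb l1 l2) (- 2) ?x = - l1 + ?x (- 2) - c1 * ?x (- 1)"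
      using empty sum_tail_split[OF stage_in_Zinf[of a n j], where k = "- 2" and F = "\<lambda>i. cartan c1 c2 I1 (iota i)"]
      by (simp add: sigma_def iota_def)
    moreover have "n = 0 \<or> n = 1 \<or> n > 1" by auto
    ultimately show ?thesis using 2 m1 m2 a1 a2 by (auto simp: a_def numeral_2_eq_2)
  next
    case 3
    have diag: "cartan c1 c2 i i = 2" for i by (cases i) auto
    have pos: "- int (Suc l) + 2 = - int (Suc p)" "- int (Suc l) + 1 = - int (Suc (Suc p))"
      using 3 by auto
    have step: "sigma (cartan c1 c2) (fund_comb l1 l2) (- int (Suc l)) ?x =
        sigma (cartan c1 c2) (fund_comb l1 l2) (- int (Suc p)) ?x
        + ?x (- int (Suc l)) + ?x (- int (Suc p))
        + cartan c1 c2 (iota (- int (Suc l))) (iota (- int (Suc (Suc p)))) * ?x (- int (Suc (Suc p)))"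
      using sigma_step[OF stage_in_Zinf, of "- int (Suc l)" "cartan c1 c2", OF _ diag,
          of "fund_comb l1 l2" a n j] 3 unfolding pos by simp
    have car: "cartan c1 c2 (iota (- int (Suc l))) (iota (- int (Suc (Suc p))))
        = - (if even p then c2 else c1)"
      unfolding iota_neg using 3 by auto
    have rec: "a (Suc (Suc (Suc p))) = (if even p then c2 else c1) * a (Suc (Suc p)) - a (Suc p)"
      by (simp add: a_def)
    have IH: "sigma (cartan c1 c2) (fund_comb l1 l2) (- int (Suc p)) ?x =
      (if p < n then 0 else if p = n then a (Suc n) - j
       else if even (p - n) then a (Suc n) - 2 * j
       else (if even n then c1 else c2) * j - a n)"
      using less 3 by simp
    consider "n > Suc (Suc p)" | "n = Suc (Suc p)" | "n = Suc p" | "n = p" | "n < p" by linarith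
    then show ?thesis
    proof cases
      case 5
      then have "even (l - n) \<longleftrightarrow> even (p - n)" using 3 by (simp add: Suc_diff_le)
      then show ?thesis unfolding step car IH stage_neg using 5 3 by simp
    qed (unfold step car IH stage_neg, use 3 rec in \<open>auto\<close>)
  qed
qed

text \<open>
  In the colour of the active position, the value \<open>a (Suc n) - j\<close> there is positive and beats the
  value \<open>0\<close> of all positions to the right. The positions to the left have \<open>a (Suc n) - 2 * j\<close>, which
  ties at the start of the round; a raising operator resolves this tie in favour of the rightmost
  maximiser.
\<close>

lemma e_op_stage:
  fixes c1 c2 l1 l2 :: int
  defines "a \<equiv> refl_seq c1 c2 l1 l2"
  assumes j: "0 \<le> j" "j < a (Suc n)"
  shows "e_op (cartan c1 c2) (fund_comb l1 l2) (iota (- int (Suc n))) (stage a n j)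
           = Some (stage a n (j + 1))"
proof -
  let ?A = "cartan c1 c2" and ?lam = "fund_comb l1 l2" and ?x = "stage a n j"
  let ?m = "- int (Suc n)"
  note neg = sigma_stage_neg[of c1 c2 l1 l2 _ n j, folded a_def]
  have top: "sigma ?A ?lam ?m ?x = a (Suc n) - j" by (subst neg) simp
  have bound: "sigma ?A ?lam k ?x \<le> a (Suc n) - j
      \<and> (sigma ?A ?lam k ?x = a (Suc n) - j \<longrightarrow> k \<le> ?m)"
    if k: "k \<noteq> 0" "iota k = iota ?m" for k
  proof (cases "k > 0")
    case True
    then show ?thesis using j by (simp add: sigma_stage_pos)
  next
    case False
    define l where "l = nat (- k) - 1"
    have kl: "k = - int (Suc l)" using False k(1) by (simp add: l_def)
    have "even l \<longleftrightarrow> even n" using k(2) unfolding kl iota_neg by (auto split: if_splits)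
    then have "l > n \<Longrightarrow> even (l - n)" by auto
    then show ?thesis unfolding kl neg using j by auto
  qed
  have "e_op ?A ?lam (iota ?m) ?x = Some (?x(?m := ?x ?m - 1))"
  proof (rule e_op_SomeI)
    show "?m \<in> M_set ?A ?lam (iota ?m) ?x"
      using bound top by (auto simp: M_set_iff_argmax[OF stage_in_Zinf])
    show "k \<le> ?m" if "k \<in> M_set ?A ?lam (iota ?m) ?x" for k
    proof -
      have "k \<noteq> 0" "iota k = iota ?m" "sigma ?A ?lam ?m ?x \<le> sigma ?A ?lam k ?x"
        using that by (simp_all add: M_set_iff_argmax[OF stage_in_Zinf])
      then show ?thesis using bound[of k] top by force
    qed
  qed
  moreover have "?x(?m := ?x ?m - 1) = stage a n (j + 1)" by (auto simp: stage_def)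
  ultimately show ?thesis by simp
qed

lemma stage_in_B0:
  fixes c1 c2 l1 l2 :: int
  defines "a \<equiv> refl_seq c1 c2 l1 l2"
  assumes "\<And>k. 1 \<le> k \<Longrightarrow> k \<le> n \<Longrightarrow> 0 \<le> a k"
  shows "stage a n 0 \<in> B0 (cartan c1 c2) (fund_comb l1 l2)"
  using assms(2)
proof (induction n)
  case 0
  have "stage a 0 0 = (\<lambda>_. 0)" by (auto simp: stage_def)
  then show ?case by (simp add: B0_def)
next
  case (Suc n)
  let ?B = "B0 (cartan c1 c2) (fund_comb l1 l2)"
  have "stage a n (int j) \<in> ?B" if "int j \<le> a (Suc n)" for j
    using that
  proof (induction j)
    case 0
    then show ?case using Suc by simp
  next
    case (Suc j)
    have "crystal_edge (cartan c1 c2) (fund_comb l1 l2) (stage a n (int j)) (stage a n (int j + 1))"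
      using e_op_stage[of "int j" c1 c2 l1 l2 n, folded a_def] Suc.prems
      unfolding crystal_edge_def by (auto simp: stage_in_Zinf)
    then show ?case using Suc
      by (auto simp: B0_def add.commute intro: equivclp_into_equivclp)
  qed
  from this[of "nat (a (Suc n))"] Suc.prems[of "Suc n"] show ?case by (simp add: stage_Suc)
qed

text \<open>
  No value exceeds \<open>0\<close>, and all positive positions have the value \<open>0\<close>. So there is no largest
  maximiser in either colour.
\<close>

lemma stage_highest:
  fixes c1 c2 l1 l2 :: int
  defines "a \<equiv> refl_seq c1 c2 l1 l2"
  assumes "0 \<le> a n" "a (Suc n) \<le> 0"
  shows "highest_weight_vector (cartan c1 c2) (fund_comb l1 l2) (stage a n 0)"
  unfolding highest_weight_vector_def
proof (intro allI e_op_NoneI)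
  fix i and m :: int
  let ?A = "cartan c1 c2" and ?lam = "fund_comb l1 l2" and ?x = "stage a n 0"
  have le: "sigma ?A ?lam k ?x \<le> 0" if "k \<noteq> 0" for k
  proof (cases "k > 0")
    case False
    define l where "l = nat (- k) - 1"
    have kl: "k = - int (Suc l)" using False that by (simp add: l_def)
    show ?thesis using assms(2,3) unfolding kl a_def sigma_stage_neg by (simp add: a_def)
  qed (simp add: sigma_stage_pos)
  define k where "k = 2 * \<bar>m\<bar> + (if i = I1 then 1 else 2)"
  have "k > 0" "m < k" "iota k = i" by (cases i; simp add: k_def iota_def; linarith)+
  then have "k \<in> M_set ?A ?lam i ?x"
    using le by (auto simp: M_set_iff_argmax[OF stage_in_Zinf] sigma_stage_pos)
  with \<open>m < k\<close> show "\<exists>k\<in>M_set ?A ?lam i ?x. m < k" by blast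
qed

lemma exists_highest:
  fixes c1 c2 l1 l2 :: int and \<alpha> \<beta> :: real
  assumes "\<alpha> + \<beta> = c1" and "c2 * (\<alpha> * \<beta>) = c1" and "0 < \<beta>" and "\<beta> \<le> \<alpha>"
    and "l1 > 0" and "l2 < 0" and "\<alpha> < l1 / (- l2)"
  shows "\<exists>b \<in> B0 (cartan c1 c2) (fund_comb l1 l2) \<inter> Zinf.
           highest_weight_vector (cartan c1 c2) (fund_comb l1 l2) b"
proof -
  let ?a = "refl_seq c1 c2 l1 l2"
  have "\<alpha> * (- l2) < l1" using assms(6,7) by (simp add: field_simps)
  then have ex: "\<exists>n. ?a n \<le> 0" using refl_seq_eventually_nonpos[of \<alpha> \<beta>] assms(1-4) by blast
  \<comment> \<open>Stopping at the first nonpositive term makes every earlier round a positive number of steps.\<close>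
  define N where "N = (LEAST n. ?a n \<le> 0)"
  have N: "?a N \<le> 0" "\<And>k. k < N \<Longrightarrow> 0 < ?a k"
    using LeastI_ex[OF ex] not_less_Least[of _ "\<lambda>n. ?a n \<le> 0"] by (auto simp: N_def not_le)
  obtain n where n: "N = Suc n" using N(1) \<open>l1 > 0\<close> by (cases N) auto
  have "stage ?a n 0 \<in> B0 (cartan c1 c2) (fund_comb l1 l2)"
    by (rule stage_in_B0) (use N(2) n in \<open>auto intro: less_imp_le\<close>)
  moreover have "highest_weight_vector (cartan c1 c2) (fund_comb l1 l2) (stage ?a n 0)"
    by (rule stage_highest) (use N n in \<open>auto intro: less_imp_le\<close>)
  ultimately show ?thesis using stage_in_Zinf by blast
qed

theorem corollary4p15:
  fixes c1 c2 l1 l2 :: int and \<alpha> \<beta> :: real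
  assumes "c1 > 0" and "c2 > 0" and "c1 * c2 \<ge> 4"
    and "l1 > 0" and "l2 < 0"
    and "\<alpha> = (of_int c1 * of_int c2
          + sqrt ((of_int c1)\<^sup>2 * (of_int c2)\<^sup>2 - 4 * of_int c1 * of_int c2)) / (2 * of_int c2)"
    and "\<beta> = (of_int c1 * of_int c2
          - sqrt ((of_int c1)\<^sup>2 * (of_int c2)\<^sup>2 - 4 * of_int c1 * of_int c2)) / (2 * of_int c2)"
  shows "(of_int l1 / (- of_int l2) > \<alpha> \<longrightarrow>
            (\<exists>b \<in> B0 (cartan c1 c2) (fund_comb l1 l2).
               highest_weight_vector (cartan c1 c2) (fund_comb l1 l2) b))
       \<and> (\<beta> > of_int l1 / (- of_int l2) \<longrightarrow>
            (\<exists>b \<in> B0 (cartan c1 c2) (fund_comb l1 l2).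
               lowest_weight_vector (cartan c1 c2) (fund_comb l1 l2) b))"
proof -
  define p q :: real where "p = of_int c1" and "q = of_int c2"
  define s where "s = sqrt (p\<^sup>2 * q\<^sup>2 - 4 * p * q)"
  have pq: "p > 0" "q > 0" "p * q \<ge> 4"
    using assms(1-3) by (simp_all add: p_def q_def flip: of_int_mult)
  have \<alpha>: "\<alpha> = (p * q + s) / (2 * q)" and \<beta>: "\<beta> = (p * q - s) / (2 * q)"
    using assms(6,7) by (simp_all add: p_def q_def s_def)
  have disc: "p\<^sup>2 * q\<^sup>2 - 4 * p * q = (p * q) * (p * q - 4)" by (simp add: algebra_simps power2_eq_square)
  have s2: "s\<^sup>2 = p\<^sup>2 * q\<^sup>2 - 4 * p * q" and s0: "s \<ge> 0" using pq by (simp_all add: s_def disc)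
  have sum: "\<alpha> + \<beta> = p" using pq by (simp add: \<alpha> \<beta> field_simps)
  have "4 * q\<^sup>2 * (\<alpha> * \<beta>) = (p * q)\<^sup>2 - s\<^sup>2"
    using pq by (simp add: \<alpha> \<beta> field_simps power2_eq_square)
  also have "\<dots> = 4 * q * p" unfolding s2 by (simp add: power_mult_distrib)
  finally have prod: "q * (\<alpha> * \<beta>) = p" using pq by (simp add: power2_eq_square)
  have le: "\<beta> \<le> \<alpha>" using s0 pq by (simp add: \<alpha> \<beta> field_simps)
  have "\<alpha> > 0" using s0 pq by (simp add: \<alpha> add_pos_nonneg)
  then have \<beta>0: "\<beta> > 0" using prod pq by (metis zero_less_mult_pos)
  have high: "\<exists>b \<in> B0 (cartan c1 c2) (fund_comb l1 l2).
      highest_weight_vector (cartan c1 c2) (fund_comb l1 l2) b" if "of_int l1 / (- of_int l2) > \<alpha>"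
    using exists_highest[of \<alpha> \<beta> c1 c2 l1 l2] sum prod \<beta>0 le assms(4,5) that
    by (auto simp: p_def q_def)
  have low: "\<exists>b \<in> B0 (cartan c1 c2) (fund_comb l1 l2).
      lowest_weight_vector (cartan c1 c2) (fund_comb l1 l2) b" if r: "\<beta> > of_int l1 / (- of_int l2)"
  proof -
    \<comment> \<open>The reciprocals of \<open>\<beta>\<close> and \<open>\<alpha>\<close> are the roots for the exchanged Cartan entries.\<close>
    have inv: "1 / \<beta> + 1 / \<alpha> = q" "p * (1 / \<beta> * (1 / \<alpha>)) = q" "1 / \<alpha> \<le> 1 / \<beta>" "0 < 1 / \<alpha>"
      using sum prod le \<beta>0 \<open>\<alpha> > 0\<close> by (auto simp: field_simps)
    have "1 / \<beta> < - of_int l2 / of_int l1"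
      using r \<beta>0 assms(4,5) by (simp add: field_simps)
    then obtain b where "b \<in> B0 (cartan c2 c1) (fund_comb (- l2) (- l1))" "b \<in> Zinf"
      "highest_weight_vector (cartan c2 c1) (fund_comb (- l2) (- l1)) b"
      using exists_highest[of "1 / \<beta>" "1 / \<alpha>" c2 c1 "- l2" "- l1"] inv assms(4,5)
      by (auto simp: p_def q_def)
    moreover have "cartan c2 c1 i i = 2" for i by (cases i) auto
    moreover have "fund_comb l1 l2 (swap i) = - fund_comb (- l2) (- l1) i" for i by (cases i) auto
    ultimately show ?thesis
      using highest_dual[of b "cartan c2 c1" "fund_comb (- l2) (- l1)" "cartan c1 c2" "fund_comb l1 l2"]
        cartan_swap by blast
  qed
  show ?thesis using high low by blast
qed

end
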